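(* Let $G$ be a finite GVZ-group. Then $c(G) \le |\mathrm{cd}(G)|$, where $c(G)$ is the nilpotence class of $G$ and $\mathrm{cd}(G)$ is the set of degrees of the irreducible complex characters of $G$.
   Context: $\mathrm{Irr}(G)$ denotes the set of irreducible complex characters of $G$, and $\mathrm{cd}(G) = \{\chi(1) \mid \chi \in \mathrm{Irr}(G)\}$. For $\chi \in \mathrm{Irr}(G)$, the center of $\chi$ is $Z(\chi) = \{ g \in G \mid |\chi(g)| = \chi(1) \}$. A finite group $G$ is a GVZ-group if $\chi(1) = |G:Z(\chi)|^{1/2}$ for every $\chi \in \mathrm{Irr}(G)$. It is a known result that GVZ-groups are nilpotent, so the nilpotence class is defined: with $G_1 = G$ and $G_{i+1} = [G_i, G]$ for $i \ge 1$ the lower central series, $c(G)$ is the smallest nonnegative integer with $G_{c(G)+1} = 1$. *)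

theory Defs
  imports "HOL-Algebra.Algebra" "Jordan_Normal_Form.VS_Connect"
begin

section \<open>Complex characters\<close>

text \<open>
  A complex representation of degree \<open>n\<close> is a homomorphism into the group of invertible
  complex \<open>n \<times> n\<close> matrices. The values of \<open>\<rho>\<close> outside the carrier of \<open>G\<close> are irrelevant.
\<close>

definition representation ::
    "('a, 'b) monoid_scheme \<Rightarrow> nat \<Rightarrow> ('a \<Rightarrow> complex mat) \<Rightarrow> bool" where
  "representation G n \<rho> \<longleftrightarrow> \<rho> \<in> hom G (units_of (ring_mat TYPE(complex) n ()))"

definition invariant_subspace ::
    "('a, 'b) monoid_scheme \<Rightarrow> nat \<Rightarrow> ('a \<Rightarrow> complex mat) \<Rightarrow> complex vec set \<Rightarrow> bool" where
  "invariant_subspace G n \<rho> W \<longleftrightarrow>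
     subspace class_ring W (module_vec TYPE(complex) n) \<and>
     (\<forall>g \<in> carrier G. \<forall>w \<in> W. \<rho> g *\<^sub>v w \<in> W)"

definition irreducible_representation ::
    "('a, 'b) monoid_scheme \<Rightarrow> nat \<Rightarrow> ('a \<Rightarrow> complex mat) \<Rightarrow> bool" where
  "irreducible_representation G n \<rho> \<longleftrightarrow>
     representation G n \<rho> \<and> 0 < n \<and>
     (\<forall>W. invariant_subspace G n \<rho> W \<longrightarrow> W = {0\<^sub>v n} \<or> W = carrier_vec n)"

definition mat_trace :: "complex mat \<Rightarrow> complex" where
  "mat_trace A = (\<Sum>i < dim_row A. A $$ (i, i))"

text \<open>
  Characters are restricted to the carrier, so that two irreducible characters that agree
  on \<open>G\<close> are the same element of \<open>Irr G\<close>.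
\<close>

definition character_of ::
    "('a, 'b) monoid_scheme \<Rightarrow> ('a \<Rightarrow> complex mat) \<Rightarrow> 'a \<Rightarrow> complex" where
  "character_of G \<rho> = (\<lambda>g \<in> carrier G. mat_trace (\<rho> g))"

definition Irr :: "('a, 'b) monoid_scheme \<Rightarrow> ('a \<Rightarrow> complex) set" where
  "Irr G = {character_of G \<rho> | n \<rho>. irreducible_representation G n \<rho>}"

definition cd :: "('a, 'b) monoid_scheme \<Rightarrow> complex set" where
  "cd G = {\<chi> \<one>\<^bsub>G\<^esub> | \<chi>. \<chi> \<in> Irr G}"

definition character_center ::
    "('a, 'b) monoid_scheme \<Rightarrow> ('a \<Rightarrow> complex) \<Rightarrow> 'a set" where
  "character_center G \<chi> = {g \<in> carrier G. complex_of_real (cmod (\<chi> g)) = \<chi> \<one>\<^bsub>G\<^esub>}"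

definition subgroup_index :: "('a, 'b) monoid_scheme \<Rightarrow> 'a set \<Rightarrow> nat" where
  "subgroup_index G H = card (rcosets\<^bsub>G\<^esub> H)"

definition GVZ_group :: "('a, 'b) monoid_scheme \<Rightarrow> bool" where
  "GVZ_group G \<longleftrightarrow>
     group G \<and> finite (carrier G) \<and>
     (\<forall>\<chi> \<in> Irr G.
        \<chi> \<one>\<^bsub>G\<^esub> = complex_of_real (sqrt (real (subgroup_index G (character_center G \<chi>)))))"

section \<open>Lower central series and nilpotence class\<close>

text \<open>
  The commutator convention is that of \<^const>\<open>derived\<close>; for subgroups \<open>H\<close> and \<open>K\<close> the
  convention \<open>[h, k] = h\<^sup>-\<^sup>1 k\<^sup>-\<^sup>1 h k\<close> yields the same subgroup.
\<close>

definition commutator_subgroup ::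
    "('a, 'b) monoid_scheme \<Rightarrow> 'a set \<Rightarrow> 'a set \<Rightarrow> 'a set" where
  "commutator_subgroup G H K =
     generate G {h \<otimes>\<^bsub>G\<^esub> k \<otimes>\<^bsub>G\<^esub> inv\<^bsub>G\<^esub> h \<otimes>\<^bsub>G\<^esub> inv\<^bsub>G\<^esub> k | h k. h \<in> H \<and> k \<in> K}"

text \<open>
  Indexing starts at \<open>0\<close>: \<open>lower_central_series G i\<close> is the term usually written
  \<open>G\<^sub>i\<^sub>+\<^sub>1\<close>, where \<open>G\<^sub>1 = G\<close> and \<open>G\<^sub>i\<^sub>+\<^sub>1 = [G\<^sub>i, G]\<close>.
\<close>

primrec lower_central_series :: "('a, 'b) monoid_scheme \<Rightarrow> nat \<Rightarrow> 'a set" where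
  "lower_central_series G 0 = carrier G"
| "lower_central_series G (Suc i) =
     commutator_subgroup G (lower_central_series G i) (carrier G)"

definition nilpotent_group :: "('a, 'b) monoid_scheme \<Rightarrow> bool" where
  "nilpotent_group G \<longleftrightarrow> group G \<and> (\<exists>c. lower_central_series G c = {\<one>\<^bsub>G\<^esub>})"

text \<open>Meaningful only for nilpotent groups; otherwise \<^const>\<open>Least\<close> is unspecified.\<close>

definition nilpotence_class :: "('a, 'b) monoid_scheme \<Rightarrow> nat" where
  "nilpotence_class G = (LEAST c. lower_central_series G c = {\<one>\<^bsub>G\<^esub>})"

end

theory Submission
  imports Defs "Jordan_Normal_Form.Spectral_Radius" "Jordan_Normal_Form.DL_Rank"
begin

text \<open>
  Let \<open>\<chi>\<close> be an irreducible character of a GVZ-group \<open>G\<close> with centre \<open>Z \<noteq> G\<close>. The degree of every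
  irreducible representation of \<open>G/Z\<close> has square strictly less than \<open>|G : Z| = \<chi>(1)\<^sup>2\<close>, so it is
  smaller than \<open>\<chi>(1)\<close>. If the \<open>i\<close>-th term of the lower central series lies in the kernels of all
  irreducible representations of degree less than \<open>\<chi>(1)\<close>, it therefore lies in \<open>Z\<close>, which is the
  intersection of the kernels of those of \<open>G/Z\<close>; and \<open>[Z, G]\<close> lies in the kernel of \<open>\<chi>\<close>.
  Hence each character degree costs one step of the series.
\<close>

section \<open>Traces and matrices of finite order\<close>

text \<open>The centre of a character is defined by absolute values of traces, while the argument
  needs scalar matrices. Schur triangular form links the two: an upper triangular matrix of finite
  order has roots of unity on its diagonal, and a trace of maximal modulus forces them to coincide.
  The quotient by \<open>Z\<close> is never formed; its representations are those of
  \<open>G\<close> that are trivial on \<open>Z\<close>. That the irreducible ones among them detect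
  \<open>Z\<close> comes from the permutation representation on the cosets, where the trace alone
  tells the elements of the subgroup from the others. Since traces add up along an invariant
  subspace, this passes down to irreducible diagonal blocks. The norm relation for characters gives
  only the weak inequality between squared degree and index. Equality has to be excluded separately,
  since degree \<open>m = n\<close> would stop the induction. Nilpotence comes out together with the
  bound, by applying the kernel criterion to the trivial subgroup.\<close>

lemma mat_trace_one [simp]: "mat_trace (1\<^sub>m n) = of_nat n"
  by (simp add: mat_trace_def)

lemma mat_trace_smult_one: "mat_trace (c \<cdot>\<^sub>m 1\<^sub>m n) = of_nat n * c"
  by (simp add: mat_trace_def)

lemma mat_trace_mult_comm:
  assumes "A \<in> carrier_mat n m" "B \<in> carrier_mat m n"
  shows "mat_trace (A * B) = mat_trace (B * A)"
proof -
  have "mat_trace (A * B) = (\<Sum>i<n. \<Sum>j<m. A $$ (i, j) * B $$ (j, i))"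
    using assms by (auto simp: mat_trace_def scalar_prod_def lessThan_atLeast0 intro!: sum.cong)
  also have "\<dots> = (\<Sum>j<m. \<Sum>i<n. B $$ (j, i) * A $$ (i, j))"
    by (subst sum.swap) (simp add: mult.commute)
  also have "\<dots> = mat_trace (B * A)"
    using assms by (auto simp: mat_trace_def scalar_prod_def lessThan_atLeast0 intro!: sum.cong)
  finally show ?thesis .
qed

lemma mat_trace_conjugate:
  assumes "A \<in> carrier_mat n n" "P \<in> carrier_mat n n" "Q \<in> carrier_mat n n" "P * Q = 1\<^sub>m n"
  shows "mat_trace (Q * A * P) = mat_trace A"
proof -
  have "mat_trace (Q * A * P) = mat_trace (P * (Q * A))"
    using assms by (intro mat_trace_mult_comm[of _ n n]) auto
  also have "P * (Q * A) = A"
    using assms by (simp flip: assoc_mult_mat[of P n n Q n A n])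
  finally show ?thesis .
qed

lemma upper_triangular_mult:
  fixes A B :: "'a :: semiring_0 mat"
  assumes "A \<in> carrier_mat n n" "B \<in> carrier_mat n n" "upper_triangular A" "upper_triangular B"
  shows "upper_triangular (A * B)"
    and "i < n \<Longrightarrow> (A * B) $$ (i, i) = A $$ (i, i) * B $$ (i, i)"
proof -
  have zero: "A $$ (i, k) * B $$ (k, j) = 0"
    if "i < n" "k < n" "k < i \<or> j < k" for i j k
    using that assms by (auto simp: upper_triangular_def)
  show "upper_triangular (A * B)"
  proof (unfold upper_triangular_def, intro allI impI)
    fix i j assume ij: "i < dim_row (A * B)" "j < i"
    have "(A * B) $$ (i, j) = (\<Sum>k = 0..<n. A $$ (i, k) * B $$ (k, j))"
      using ij assms by (simp add: scalar_prod_def)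
    also have "\<dots> = 0"
      using ij assms by (intro sum.neutral ballI zero) auto
    finally show "(A * B) $$ (i, j) = 0" .
  qed
  assume i: "i < n"
  have "(A * B) $$ (i, i) = (\<Sum>k = 0..<n. A $$ (i, k) * B $$ (k, i))"
    using i assms by (simp add: scalar_prod_def)
  also have "\<dots> = (\<Sum>k\<in>{i}. A $$ (i, k) * B $$ (k, i))"
    using i by (intro sum.mono_neutral_right ballI zero) auto
  finally show "(A * B) $$ (i, i) = A $$ (i, i) * B $$ (i, i)" by simp
qed

lemma upper_triangular_pow:
  fixes A :: "'a :: semiring_1 mat"
  assumes "A \<in> carrier_mat n n" "upper_triangular A"
  shows "upper_triangular (A ^\<^sub>m k) \<and> (\<forall>i<n. (A ^\<^sub>m k) $$ (i, i) = A $$ (i, i) ^ k)"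
proof (induction k)
  case (Suc k)
  then show ?case
    using assms upper_triangular_mult[of "A ^\<^sub>m k" n A]
    by (auto simp: power_commutes)
qed (use assms in \<open>auto simp: upper_triangular_def\<close>)

lemma complex_mat_similar_upper_triangular:
  fixes A :: "complex mat"
  assumes "A \<in> carrier_mat n n"
  obtains T P Q where "similar_mat_wit A T P Q" "upper_triangular T"
  using char_poly_factorized[OF assms] schur_decomposition[OF assms] by (metis prod_cases3)

lemma root_of_unity_cnj:
  fixes z :: complex
  assumes "z ^ m = 1" "m > 0"
  shows "cmod z = 1" "z ^ (m - 1) = cnj z"
proof -
  have "cmod z ^ m = 1" using assms by (metis norm_one norm_power)
  then show n: "cmod z = 1" using assms(2) power_eq_imp_eq_base[of "cmod z" m 1] by simp
  have "z * z ^ (m - 1) = 1" using assms by (metis power_eq_if gr_implies_not0)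
  moreover have "z * cnj z = 1" using n by (simp add: complex_norm_square[symmetric])
  ultimately show "z ^ (m - 1) = cnj z"
    by (metis mult_cancel_left mult_zero_left zero_neq_one)
qed

text \<open>Triangular form takes the place of diagonalisation: powers act entrywise on the
  diagonal, so the eigenvalues are roots of unity.\<close>

lemma finite_order_mat_triangular:
  fixes A :: "complex mat"
  assumes A: "A \<in> carrier_mat n n" and pow: "A ^\<^sub>m m = 1\<^sub>m n"
  obtains T P Q where "similar_mat_wit A T P Q" "upper_triangular T" "T ^\<^sub>m m = 1\<^sub>m n"
    "\<And>i. i < n \<Longrightarrow> T $$ (i, i) ^ m = 1"
proof -
  obtain T P Q where sim: "similar_mat_wit A T P Q" and T: "upper_triangular T"
    using complex_mat_similar_upper_triangular[OF A] .
  note PQ = similar_mat_witD2[OF A sim]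
  have "T ^\<^sub>m m = Q * 1\<^sub>m n * P"
    using similar_mat_wit_pow_id[OF similar_mat_wit_sym[OF sim], of m] pow by simp
  then have one: "T ^\<^sub>m m = 1\<^sub>m n" using PQ by simp
  have "T $$ (i, i) ^ m = 1" if "i < n" for i
    using upper_triangular_pow[OF PQ(5) T, of m] that one by auto
  then show thesis using that sim T one by blast
qed

lemma mat_trace_similar:
  assumes A: "A \<in> carrier_mat n n" and "similar_mat_wit A B P Q"
  shows "mat_trace A = mat_trace B"
  using similar_mat_witD2[OF assms] mat_trace_conjugate[of B n Q P] by simp

text \<open>\<open>A ^\<^sub>m (m - 1)\<close> is the inverse of \<open>A\<close>, and inverting an
  eigenvalue on the unit circle means conjugating it.\<close>

lemma mat_trace_finite_order_inverse:
  fixes A :: "complex mat"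
  assumes A: "A \<in> carrier_mat n n" and pow: "A ^\<^sub>m m = 1\<^sub>m n" and "m > 0"
  shows "mat_trace (A ^\<^sub>m (m - 1)) = cnj (mat_trace A)"
proof -
  obtain T P Q where sim: "similar_mat_wit A T P Q" and T: "upper_triangular T"
    and root: "\<And>i. i < n \<Longrightarrow> T $$ (i, i) ^ m = 1"
    using finite_order_mat_triangular[OF A pow] by metis
  have carr: "T \<in> carrier_mat n n" using similar_mat_witD2[OF A sim] by simp
  have "mat_trace (A ^\<^sub>m (m - 1)) = mat_trace (T ^\<^sub>m (m - 1))"
    using A similar_mat_wit_pow[OF sim] by (intro mat_trace_similar) auto
  also have "\<dots> = (\<Sum>i<n. T $$ (i, i) ^ (m - 1))"
    using carr upper_triangular_pow[OF carr T, of "m - 1"] by (simp add: mat_trace_def)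
  also have "\<dots> = (\<Sum>i<n. cnj (T $$ (i, i)))"
    using root_of_unity_cnj(2)[OF root \<open>m > 0\<close>] by simp
  also have "\<dots> = cnj (mat_trace T)" using carr by (simp add: mat_trace_def)
  finally show ?thesis using mat_trace_similar[OF A sim] by simp
qed

text \<open>In characteristic zero \<open>X\<^sup>m - c\<^sup>m\<close> has the simple root \<open>c\<close>, so the cofactor
  \<open>\<Sum>k<m. T\<^sup>k c\<^sup>m\<^sup>-\<^sup>1\<^sup>-\<^sup>k\<close> of \<open>T - c\<close> is invertible.\<close>

lemma upper_triangular_finite_order_const_diag:
  fixes T :: "complex mat"
  assumes T: "T \<in> carrier_mat n n" "upper_triangular T" and pow: "T ^\<^sub>m m = 1\<^sub>m n" and "m > 0"
    and diag: "\<And>i. i < n \<Longrightarrow> T $$ (i, i) = c" and c: "c ^ m = 1"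
  shows "T = c \<cdot>\<^sub>m 1\<^sub>m n"
proof -
  let ?D = "T - c \<cdot>\<^sub>m 1\<^sub>m n"
  have D: "?D \<in> carrier_mat n n" using T by auto
  \<comment> \<open>Induction on \<open>k\<close> for the cofactor of \<open>T - c\<close> in
    \<open>T^k - c^k\<close>, with the recursion \<open>U' = U * T + c^k\<close>. The diagonal value
    \<open>k * c^(k-1)\<close> is the derivative of \<open>X^k\<close> at \<open>c\<close>.\<close>
  have "\<exists>U \<in> carrier_mat n n. upper_triangular U \<and> (\<forall>i<n. U $$ (i, i) = of_nat k * c ^ (k - 1))
      \<and> ?D * U = T ^\<^sub>m k - c ^ k \<cdot>\<^sub>m 1\<^sub>m n" for k
  proof (induction k)
    case 0
    show ?case
      using T D by (intro bexI[of _ "0\<^sub>m n n"]) (auto simp: upper_triangular_def)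
  next
    case (Suc k)
    then obtain U where U: "U \<in> carrier_mat n n" "upper_triangular U"
      "\<And>i. i < n \<Longrightarrow> U $$ (i, i) = of_nat k * c ^ (k - 1)"
      "?D * U = T ^\<^sub>m k - c ^ k \<cdot>\<^sub>m 1\<^sub>m n" by blast
    let ?V = "U * T + c ^ k \<cdot>\<^sub>m 1\<^sub>m n"
    note UT = upper_triangular_mult[OF U(1) T(1) U(2) T(2)]
    have Tk: "T ^\<^sub>m k \<in> carrier_mat n n" using T by simp
    have "?D * ?V = ?D * (U * T) + ?D * (c ^ k \<cdot>\<^sub>m 1\<^sub>m n)"
      using D U T by (intro mult_add_distrib_mat) auto
    also have "?D * (U * T) = (T ^\<^sub>m k - c ^ k \<cdot>\<^sub>m 1\<^sub>m n) * T"
      using D U T by (simp flip: assoc_mult_mat[of ?D n n U n T n])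
    also have "\<dots> = T ^\<^sub>m k * T - c ^ k \<cdot>\<^sub>m T"
      using T Tk by (subst minus_mult_distrib_mat[of _ n n]) auto
    also have "?D * (c ^ k \<cdot>\<^sub>m 1\<^sub>m n) = c ^ k \<cdot>\<^sub>m ?D"
      using D by (subst mult_smult_distrib[OF D]) auto
    also have "T ^\<^sub>m k * T - c ^ k \<cdot>\<^sub>m T + c ^ k \<cdot>\<^sub>m ?D = T ^\<^sub>m Suc k - c ^ Suc k \<cdot>\<^sub>m 1\<^sub>m n"
      using T Tk by (intro eq_matI) (auto simp: algebra_simps simp del: index_mult_mat(1))
    finally have "?D * ?V = T ^\<^sub>m Suc k - c ^ Suc k \<cdot>\<^sub>m 1\<^sub>m n" .
    moreover have "upper_triangular ?V"
      using UT(1) U(1) T(1) by (auto simp: upper_triangular_def simp del: index_mult_mat(1))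
    \<comment> \<open>For \<open>k = 0\<close> the truncated exponent \<open>k - 1\<close> is
      harmless because the factor \<open>of_nat k\<close> vanishes; hence the case split.\<close>
    moreover have "?V $$ (i, i) = of_nat (Suc k) * c ^ (Suc k - 1)" if "i < n" for i
      using that UT(2)[OF that] U(1,3) T(1) diag
      by (cases k) (auto simp: algebra_simps simp del: index_mult_mat(1))
    ultimately show ?case using U(1) T(1) by (intro bexI[of _ ?V]) auto
  qed
  then obtain U where U: "U \<in> carrier_mat n n" "upper_triangular U"
    "\<And>i. i < n \<Longrightarrow> U $$ (i, i) = of_nat m * c ^ (m - 1)"
    "?D * U = T ^\<^sub>m m - c ^ m \<cdot>\<^sub>m 1\<^sub>m n" by blast
  have "c \<noteq> 0" using c \<open>m > 0\<close> by (auto simp: power_0_left)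
  then have "det U \<noteq> 0"
    using U(1,3) \<open>m > 0\<close> by (auto simp: det_upper_triangular[OF U(2,1)] prod_list_zero_iff diag_mat_def)
  then obtain V where V: "V \<in> carrier_mat n n" "U * V = 1\<^sub>m n"
    using det_non_zero_imp_unit[OF U(1)] by (auto simp: Units_def ring_mat_simps)
  have "?D = ?D * (U * V)" using V D by simp
  also have "\<dots> = (?D * U) * V" using assoc_mult_mat[OF D U(1) V(1)] by simp
  also have "?D * U = 0\<^sub>m n n" using U(4) pow c by (auto intro!: eq_matI)
  finally have "?D = 0\<^sub>m n n" using V by simp
  then have "?D $$ (i, j) = 0" if "i < n" "j < n" for i j
    using that by simp
  then show ?thesis
    using T by (intro eq_matI) auto
qed

text \<open>The equality case of the triangle inequality. The mean \<open>u\<close> has modulus one,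
  so each \<open>Re (cnj u * z j)\<close> is at most 1, while these real parts add up to
  \<open>card I\<close>; hence every one of them equals 1.\<close>

lemma unit_complex_sum_extremal:
  fixes z :: "'i \<Rightarrow> complex"
  assumes fin: "finite I" and unit: "\<And>i. i \<in> I \<Longrightarrow> cmod (z i) = 1" and sum: "cmod (sum z I) = card I"
    and i: "i \<in> I"
  shows "z i = sum z I / of_nat (card I)"
proof -
  define u where "u = sum z I / of_nat (card I)"
  have pos: "card I > 0" using fin i card_gt_0_iff by blast
  have u: "cmod u = 1" using sum pos by (simp add: u_def norm_divide)
  have uu: "cnj u * u = 1" using u by (simp add: complex_norm_square[symmetric] mult.commute)
  have le: "Re (cnj u * z j) \<le> 1" if "j \<in> I" for j
    using complex_Re_le_cmod[of "cnj u * z j"] unit[OF that] u by (simp add: norm_mult)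
  have "(\<Sum>j\<in>I. 1 - Re (cnj u * z j)) = card I - Re (cnj u * sum z I)"
    by (simp add: sum_subtractf sum_distrib_left)
  also have "cnj u * sum z I = of_nat (card I) * (cnj u * u)"
    using pos by (simp add: u_def)
  finally have "(\<Sum>j\<in>I. 1 - Re (cnj u * z j)) = 0" using uu by simp
  then have "Re (cnj u * z i) = 1"
    using sum_nonneg_eq_0_iff[of I "\<lambda>j. 1 - Re (cnj u * z j)"] fin le i by simp
  moreover have "cmod (cnj u * z i) = 1" using u unit[OF i] by (simp add: norm_mult)
  ultimately have "cnj u * z i = 1"
    by (metis cmod_eq_Re complex_eq_iff norm_complex_def one_complex.simps cmod_power2 add_right_cancel 
      add_cancel_left_right power_one zero_eq_power2)
  then show ?thesis
    using uu unfolding u_def[symmetric] by (metis mult_cancel_left mult_zero_left zero_neq_one)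
qed

lemma finite_order_mat_scalar:
  fixes A :: "complex mat"
  assumes A: "A \<in> carrier_mat n n" and pow: "A ^\<^sub>m m = 1\<^sub>m n" and "m > 0"
    and tr: "cmod (mat_trace A) = n"
  shows "\<exists>c. A = c \<cdot>\<^sub>m 1\<^sub>m n"
proof -
  obtain T P Q where sim: "similar_mat_wit A T P Q" and T: "upper_triangular T" and
    powT: "T ^\<^sub>m m = 1\<^sub>m n" and root: "\<And>i. i < n \<Longrightarrow> T $$ (i, i) ^ m = 1"
    using finite_order_mat_triangular[OF A pow] by metis
  note PQ = similar_mat_witD2[OF A sim]
  \<comment> \<open>The value 1 for \<open>n = 0\<close> keeps \<open>c ^ m = 1\<close> true when
    there is no diagonal entry.\<close>
  define c where "c = (if n = 0 then 1 else T $$ (0, 0))"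
  have sum: "mat_trace A = (\<Sum>i<n. T $$ (i, i))"
    using PQ(5) mat_trace_similar[OF A sim] by (simp add: mat_trace_def)
  have all: "T $$ (i, i) = (\<Sum>i<n. T $$ (i, i)) / of_nat (card {..<n})" if "i < n" for i
    by (rule unit_complex_sum_extremal[of "{..<n}" "\<lambda>i. T $$ (i, i)"])
      (use tr sum root_of_unity_cnj(1)[OF root \<open>m > 0\<close>] that in auto)
  have "T $$ (i, i) = c" if "i < n" for i
    using all[OF that] all[of 0] that by (simp add: c_def)
  moreover have "c ^ m = 1" using root by (simp add: c_def)
  ultimately have "T = c \<cdot>\<^sub>m 1\<^sub>m n"
    using upper_triangular_finite_order_const_diag[OF PQ(5) T powT \<open>m > 0\<close>] by blast
  then have "A = c \<cdot>\<^sub>m P * Q"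
    using PQ(3,6) mult_smult_distrib[OF PQ(6) one_carrier_mat[of n], of c] by simp
  also have "\<dots> = c \<cdot>\<^sub>m 1\<^sub>m n"
    using mult_smult_assoc_mat[OF PQ(6,7)] PQ(1) by simp
  finally show ?thesis by blast
qed

lemma mat_trace_smult: "A \<in> carrier_mat n n \<Longrightarrow> mat_trace (c \<cdot>\<^sub>m A) = c * mat_trace A"
  by (simp add: mat_trace_def sum_distrib_left)

section \<open>Complex representations of finite groups\<close>

text \<open>Invertibility is recovered from \<open>\<rho> (inv g)\<close>, so later constructions
  only have to check multiplicativity and the value at the identity.\<close>

lemma (in group) representation_iff:
  "representation G n \<rho> \<longleftrightarrow>
    (\<forall>g \<in> carrier G. \<rho> g \<in> carrier_mat n n) \<and> \<rho> \<one> = 1\<^sub>m n \<and>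
    (\<forall>g \<in> carrier G. \<forall>h \<in> carrier G. \<rho> (g \<otimes> h) = \<rho> g * \<rho> h)"
  (is "_ \<longleftrightarrow> ?R")
proof -
  let ?M = "ring_mat TYPE(complex) n ()"
  interpret M: ring ?M by (rule ring_mat)
  interpret U: group "units_of ?M" by (rule M.units_group)
  show ?thesis
  proof
    assume rep: "representation G n \<rho>"
    then have hom: "\<rho> \<in> hom G (units_of ?M)" by (simp add: representation_def)
    then have "\<rho> \<one> = \<one>\<^bsub>units_of ?M\<^esub>"
      by (intro hom_one) (auto simp: group_axioms U.group_axioms)
    with hom show ?R
      by (auto simp: hom_def units_of_def Units_def ring_mat_simps Pi_iff)
  next
    assume R: ?R
    have "\<rho> g \<in> Units ?M" if g: "g \<in> carrier G" for g
    proof -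
      have "\<rho> g * \<rho> (inv g) = 1\<^sub>m n" "\<rho> (inv g) * \<rho> g = 1\<^sub>m n"
        using R g by (metis inv_closed r_inv, metis inv_closed l_inv)
      then show ?thesis using R g by (auto simp: Units_def ring_mat_simps)
    qed
    then show "representation G n \<rho>"
      using R by (auto simp: representation_def hom_def units_of_def ring_mat_simps)
  qed
qed

lemma invariant_subspace_iff:
  "invariant_subspace G n \<rho> W \<longleftrightarrow>
    W \<subseteq> carrier_vec n \<and> 0\<^sub>v n \<in> W \<and> (\<forall>v \<in> W. \<forall>w \<in> W. v + w \<in> W) \<and>
    (\<forall>c. \<forall>v \<in> W. c \<cdot>\<^sub>v v \<in> W) \<and> (\<forall>g \<in> carrier G. \<forall>w \<in> W. \<rho> g *\<^sub>v w \<in> W)"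
  by (auto simp: invariant_subspace_def subspace_def submodule_def vec_vs vec_module
      module_vec_simps class_ring_simps)

text \<open>Sums of square matrices are taken entrywise to avoid the carrier-bound sums of
  \<open>ring_mat\<close>.\<close>

definition mat_sum :: "nat \<Rightarrow> 'i set \<Rightarrow> ('i \<Rightarrow> 'a :: semiring_0 mat) \<Rightarrow> 'a mat" where
  "mat_sum n I M = mat n n (\<lambda>(i, j). \<Sum>x\<in>I. M x $$ (i, j))"

lemma mat_sum_carrier [simp]: "mat_sum n I M \<in> carrier_mat n n"
  by (simp add: mat_sum_def)

lemma mat_sum_index [simp]: "i < n \<Longrightarrow> j < n \<Longrightarrow> mat_sum n I M $$ (i, j) = (\<Sum>x\<in>I. M x $$ (i, j))"
  by (simp add: mat_sum_def)

lemma mult_mat_sum: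
  assumes "A \<in> carrier_mat n n" "\<And>x. x \<in> I \<Longrightarrow> M x \<in> carrier_mat n n"
  shows "A * mat_sum n I M = mat_sum n I (\<lambda>x. A * M x)"
proof (rule eq_matI)
  fix i j assume "i < dim_row (mat_sum n I (\<lambda>x. A * M x))" "j < dim_col (mat_sum n I (\<lambda>x. A * M x))"
  then have ij: "i < n" "j < n" by (auto simp: mat_sum_def)
  have "(A * mat_sum n I M) $$ (i, j) = (\<Sum>k = 0..<n. \<Sum>x\<in>I. A $$ (i, k) * M x $$ (k, j))"
    using ij assms(1) by (simp add: scalar_prod_def mat_sum_def sum_distrib_left)
  also have "\<dots> = (\<Sum>x\<in>I. \<Sum>k = 0..<n. A $$ (i, k) * M x $$ (k, j))"
    by (rule sum.swap)
  also have "\<dots> = mat_sum n I (\<lambda>x. A * M x) $$ (i, j)"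
    using ij assms(1) by (auto simp: scalar_prod_def dest: assms(2) intro!: sum.cong)
  finally show "(A * mat_sum n I M) $$ (i, j) = mat_sum n I (\<lambda>x. A * M x) $$ (i, j)" .
qed (use assms in \<open>auto simp: mat_sum_def\<close>)

lemma mat_sum_mult:
  assumes "A \<in> carrier_mat n n" "\<And>x. x \<in> I \<Longrightarrow> M x \<in> carrier_mat n n"
  shows "mat_sum n I M * A = mat_sum n I (\<lambda>x. M x * A)"
proof (rule eq_matI)
  fix i j assume "i < dim_row (mat_sum n I (\<lambda>x. M x * A))" "j < dim_col (mat_sum n I (\<lambda>x. M x * A))"
  then have ij: "i < n" "j < n" by (auto simp: mat_sum_def)
  have "(mat_sum n I M * A) $$ (i, j) = (\<Sum>k = 0..<n. \<Sum>x\<in>I. M x $$ (i, k) * A $$ (k, j))"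
    using ij assms(1) by (simp add: scalar_prod_def mat_sum_def sum_distrib_right)
  also have "\<dots> = (\<Sum>x\<in>I. \<Sum>k = 0..<n. M x $$ (i, k) * A $$ (k, j))"
    by (rule sum.swap)
  also have "\<dots> = mat_sum n I (\<lambda>x. M x * A) $$ (i, j)"
    using ij assms(1) by (auto simp: scalar_prod_def dest: assms(2) intro!: sum.cong)
  finally show "(mat_sum n I M * A) $$ (i, j) = mat_sum n I (\<lambda>x. M x * A) $$ (i, j)" .
qed (use assms in \<open>auto simp: mat_sum_def\<close>)

lemma mat_trace_mat_sum:
  assumes "\<And>x. x \<in> I \<Longrightarrow> M x \<in> carrier_mat n n"
  shows "mat_trace (mat_sum n I M) = (\<Sum>x\<in>I. mat_trace (M x))"
proof -
  have "mat_trace (mat_sum n I M) = (\<Sum>i<n. \<Sum>x\<in>I. M x $$ (i, i))"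
    by (simp add: mat_trace_def mat_sum_def)
  also have "\<dots> = (\<Sum>x\<in>I. mat_trace (M x))"
    by (subst sum.swap) (auto simp: mat_trace_def dest: assms intro!: sum.cong)
  finally show ?thesis .
qed

section \<open>Representations of a finite group: inverses, centres of characters, kernels\<close>

locale finite_group_representation = group G for G (structure) +
  fixes n :: nat and \<rho> :: "'a \<Rightarrow> complex mat"
  assumes finite_carrier: "finite (carrier G)"
    and rep: "representation G n \<rho>"
begin

lemma rho_carrier: "g \<in> carrier G \<Longrightarrow> \<rho> g \<in> carrier_mat n n"
  and rho_one: "\<rho> \<one> = 1\<^sub>m n"
  and rho_mult: "g \<in> carrier G \<Longrightarrow> h \<in> carrier G \<Longrightarrow> \<rho> (g \<otimes> h) = \<rho> g * \<rho> h"
  using rep by (auto simp: representation_iff)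

lemma rho_inv:
  assumes "g \<in> carrier G"
  shows "\<rho> g * \<rho> (inv g) = 1\<^sub>m n" "\<rho> (inv g) * \<rho> g = 1\<^sub>m n"
  using assms by (simp_all flip: rho_mult add: rho_one)

lemma rho_pow: "g \<in> carrier G \<Longrightarrow> \<rho> (g [^] (k :: nat)) = \<rho> g ^\<^sub>m k"
proof (induction k)
  case 0
  then show ?case using rho_carrier[of g] by (auto simp: rho_one)
qed (simp add: rho_mult)

lemma rho_pow_order: "g \<in> carrier G \<Longrightarrow> \<rho> g ^\<^sub>m Coset.order G = 1\<^sub>m n"
  using rho_pow[of g "Coset.order G"] by (simp add: pow_order_eq_1 rho_one)

lemma order_pos: "Coset.order G > 0"
  using finite_carrier order_gt_0_iff_finite by blast

lemma mat_trace_rho_inv: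
  assumes g: "g \<in> carrier G"
  shows "mat_trace (\<rho> (inv g)) = cnj (mat_trace (\<rho> g))"
proof -
  have "g [^] (Coset.order G - 1) \<otimes> g = \<one>"
    using g order_pos pow_order_eq_1[OF g] by (metis Suc_diff_1 nat_pow_Suc)
  then have "inv g = g [^] (Coset.order G - 1)"
    using g by (simp add: inv_equality)
  then show ?thesis
    using g mat_trace_finite_order_inverse[OF rho_carrier rho_pow_order order_pos, OF g g]
    by (simp add: rho_pow)
qed

lemma character_one: "character_of G \<rho> \<one> = of_nat n"
  by (simp add: character_of_def rho_one)

text \<open>Trace of modulus \<open>n\<close> forces a scalar matrix by
  \<open>finite_order_mat_scalar\<close>. Conversely the scalar is a root of unity, because its
  power with exponent the group order is 1.\<close>

lemma character_center_eq:
  "character_center G (character_of G \<rho>) = {g \<in> carrier G. \<exists>c. \<rho> g = c \<cdot>\<^sub>m 1\<^sub>m n}"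
proof (intro equalityI subsetI; clarsimp simp: character_center_def character_one)
  fix g assume g: "g \<in> carrier G" "complex_of_real (cmod (character_of G \<rho> g)) = of_nat n"
  then have "cmod (mat_trace (\<rho> g)) = n"
    by (metis character_of_def of_real_eq_iff of_real_of_nat_eq restrict_apply')
  then show "\<exists>c. \<rho> g = c \<cdot>\<^sub>m 1\<^sub>m n"
    by (intro finite_order_mat_scalar[OF rho_carrier rho_pow_order order_pos]) (use g in auto)
next
  fix g c assume g: "g \<in> carrier G" "\<rho> g = c \<cdot>\<^sub>m 1\<^sub>m n"
  have "of_nat n * cmod c = n"
  proof (cases "n = 0")
    case False
    have "upper_triangular (\<rho> g)" using g by (auto simp: upper_triangular_def)
    then have "(\<rho> g $$ (0, 0)) ^ Coset.order G = 1"
      using upper_triangular_pow[OF rho_carrier[OF g(1)], of "Coset.order G"] rho_pow_order[OF g(1)] False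
      by auto
    then show ?thesis
      using False g(2) root_of_unity_cnj(1)[OF _ order_pos, of c] by simp
  qed simp
  then show "complex_of_real (cmod (character_of G \<rho> g)) = of_nat n"
    using g by (simp add: character_of_def mat_trace_smult_one norm_mult)
qed

lemma smult_one_commute:
  assumes "A \<in> carrier_mat n n"
  shows "(c \<cdot>\<^sub>m 1\<^sub>m n) * A = c \<cdot>\<^sub>m (A :: complex mat)" "A * (c \<cdot>\<^sub>m 1\<^sub>m n) = c \<cdot>\<^sub>m A"
  using assms mult_smult_distrib[OF assms one_carrier_mat] mult_smult_assoc_mat[OF one_carrier_mat assms]
  by auto

lemma character_center_normal: "character_center G (character_of G \<rho>) \<lhd> G"
proof -
  let ?Z = "{g \<in> carrier G. \<exists>c. \<rho> g = c \<cdot>\<^sub>m 1\<^sub>m n}"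
  have conj: "\<rho> (x \<otimes> g \<otimes> inv x) = c \<cdot>\<^sub>m 1\<^sub>m n"
    if "x \<in> carrier G" "g \<in> carrier G" "\<rho> g = c \<cdot>\<^sub>m 1\<^sub>m n" for x g c
    using that rho_carrier[of x] rho_carrier[of "inv x"]
    by (simp add: rho_mult smult_one_commute mult_smult_assoc_mat[of _ n n] rho_inv)
  have "subgroup ?Z G"
  proof (rule subgroupI)
    show "?Z \<noteq> {}"
      using rho_one by (auto intro!: exI[of _ \<one>] exI[of _ 1] eq_matI)
  next
    fix a assume "a \<in> ?Z"
    then obtain c where a: "a \<in> carrier G" "\<rho> a = c \<cdot>\<^sub>m 1\<^sub>m n" by blast
    let ?B = "\<rho> (inv a)"
    have B: "?B \<in> carrier_mat n n" using a by (simp add: rho_carrier)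
    have "c \<cdot>\<^sub>m ?B = 1\<^sub>m n" using rho_inv(1)[OF a(1)] a(2) B by (simp add: smult_one_commute)
    then have e: "c * ?B $$ (i, j) = (if i = j then 1 else 0)" if "i < n" "j < n" for i j
      using that B by (metis carrier_matD index_smult_mat(1) index_one_mat(1))
    \<comment> \<open>As soon as there is an entry to compare, the diagonal case of \<open>e\<close>
      rules out \<open>c = 0\<close>; for \<open>n = 0\<close> any scalar would do.\<close>
    have "?B = (1 / c) \<cdot>\<^sub>m 1\<^sub>m n"
    proof (rule eq_matI)
      fix i j assume "i < dim_row ((1 / c) \<cdot>\<^sub>m 1\<^sub>m n)" "j < dim_col ((1 / c) \<cdot>\<^sub>m 1\<^sub>m n)"
      then show "?B $$ (i, j) = ((1 / c) \<cdot>\<^sub>m 1\<^sub>m n) $$ (i, j)"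
        using e[of i j] e[of i i] by (cases "c = 0") (auto simp: nonzero_eq_divide_eq mult.commute)
    qed (use B in auto)
    then show "inv a \<in> ?Z" using a by auto
  next
    fix a b assume "a \<in> ?Z" "b \<in> ?Z"
    then obtain c d where "a \<in> carrier G" "\<rho> a = c \<cdot>\<^sub>m 1\<^sub>m n" "b \<in> carrier G" "\<rho> b = d \<cdot>\<^sub>m 1\<^sub>m n"
      by blast
    then show "a \<otimes> b \<in> ?Z"
      by (auto simp: rho_mult smult_one_commute intro!: exI[of _ "c * d"])
  qed auto
  then show ?thesis
    unfolding character_center_eq normal_inv_iff using conj by blast
qed

lemma commutator_center_trivial:
  assumes "z \<in> character_center G (character_of G \<rho>)" "g \<in> carrier G"
  shows "\<rho> (z \<otimes> g \<otimes> inv z \<otimes> inv g) = 1\<^sub>m n"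
proof -
  obtain c where z: "z \<in> carrier G" "\<rho> z = c \<cdot>\<^sub>m 1\<^sub>m n"
    using assms(1) by (auto simp: character_center_eq)
  note carr = rho_carrier[OF z(1)] rho_carrier[OF assms(2)]
    rho_carrier[OF inv_closed[OF z(1)]] rho_carrier[OF inv_closed[OF assms(2)]]
  have "\<rho> z * \<rho> g = \<rho> g * \<rho> z"
    using carr(2) z(2) by (simp add: smult_one_commute)
  then have "\<rho> (z \<otimes> g \<otimes> inv z \<otimes> inv g) = \<rho> g * \<rho> z * \<rho> (inv z) * \<rho> (inv g)"
    using z assms(2) by (simp add: rho_mult)
  also have "\<rho> g * \<rho> z * \<rho> (inv z) = \<rho> g"
    using assoc_mult_mat[OF carr(2,1,3)] rho_inv(1)[OF z(1)] carr by simp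
  finally show ?thesis using rho_inv(1)[OF assms(2)] by simp
qed

lemma subgroup_kernel: "subgroup {g \<in> carrier G. \<rho> g = 1\<^sub>m n} G"
proof (rule subgroupI)
  fix a assume "a \<in> {g \<in> carrier G. \<rho> g = 1\<^sub>m n}"
  then show "inv a \<in> {g \<in> carrier G. \<rho> g = 1\<^sub>m n}"
    using rho_inv(1)[of a] rho_carrier[of "inv a"] by simp
qed (use rho_one in \<open>auto simp: rho_mult\<close>)

lemma sum_mult_left:
  assumes "h \<in> carrier G"
  shows "(\<Sum>g\<in>carrier G. f (h \<otimes> g)) = (\<Sum>g\<in>carrier G. f g)"
  using assms by (intro sum.reindex_bij_witness[of _ "\<lambda>g. inv h \<otimes> g" "\<lambda>g. h \<otimes> g"])
    (auto simp flip: m_assoc)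

lemma sum_mult_right:
  assumes "h \<in> carrier G"
  shows "(\<Sum>g\<in>carrier G. f (g \<otimes> h)) = (\<Sum>g\<in>carrier G. f g)"
  using assms by (intro sum.reindex_bij_witness[of _ "\<lambda>g. g \<otimes> inv h" "\<lambda>g. g \<otimes> h"])
    (auto simp: m_assoc)

end

section \<open>Irreducible representations: Schur's lemma and the norm of a character\<close>

locale finite_group_irrep = group G for G (structure) +
  fixes n :: nat and \<rho> :: "'a \<Rightarrow> complex mat"
  assumes finite_carrier': "finite (carrier G)"
    and irrep: "irreducible_representation G n \<rho>"

sublocale finite_group_irrep \<subseteq> finite_group_representation
  using finite_carrier' irrep
  by unfold_locales (auto simp: irreducible_representation_def)

context finite_group_irrep
begin

lemma degree_pos: "n > 0"
  using irrep by (simp add: irreducible_representation_def)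

text \<open>An eigenspace of \<open>A\<close> is invariant because \<open>A\<close> commutes with
  the representation. Over the complex numbers with \<open>n > 0\<close> some eigenspace is nonzero,
  hence everything.\<close>

lemma schur:
  assumes A: "A \<in> carrier_mat n n" and comm: "\<And>g. g \<in> carrier G \<Longrightarrow> \<rho> g * A = A * \<rho> g"
  shows "\<exists>c. A = c \<cdot>\<^sub>m 1\<^sub>m n"
proof -
  obtain c v where v: "v \<in> carrier_vec n" "v \<noteq> 0\<^sub>v n" "A *\<^sub>v v = c \<cdot>\<^sub>v v"
    using spectrum_non_empty[OF A degree_pos] A
    by (auto simp: spectrum_def eigenvalue_def eigenvector_def)
  define W where "W = {w \<in> carrier_vec n. A *\<^sub>v w = c \<cdot>\<^sub>v w}"
  have "invariant_subspace G n \<rho> W"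
    unfolding invariant_subspace_iff
  proof (intro conjI ballI allI)
    fix g w assume g: "g \<in> carrier G" and w: "w \<in> W"
    note r = rho_carrier[OF g]
    have "A *\<^sub>v (\<rho> g *\<^sub>v w) = (A * \<rho> g) *\<^sub>v w"
      using A r w by (simp add: W_def)
    also have "\<dots> = \<rho> g *\<^sub>v (A *\<^sub>v w)"
      using comm[OF g] A r w by (simp flip: comm[OF g] add: W_def)
    also have "\<dots> = c \<cdot>\<^sub>v (\<rho> g *\<^sub>v w)"
      using r w by (simp add: W_def mult_mat_vec)
    finally show "\<rho> g *\<^sub>v w \<in> W" using r w by (simp add: W_def)
  qed (use A in \<open>auto simp: W_def mult_add_distrib_mat_vec smult_add_distrib_vec mult_mat_vec
      smult_smult_assoc mult.commute\<close>)
  moreover have "W \<noteq> {0\<^sub>v n}" using v by (auto simp: W_def)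
  ultimately have W: "W = carrier_vec n"
    using irrep by (auto simp: irreducible_representation_def)
  have "A = c \<cdot>\<^sub>m 1\<^sub>m n"
  proof (rule eq_matI)
    fix i j assume "i < dim_row (c \<cdot>\<^sub>m 1\<^sub>m n)" "j < dim_col (c \<cdot>\<^sub>m 1\<^sub>m n)"
    then have ij: "i < n" "j < n" by auto
    have "unit_vec n j \<in> W" by (simp add: W)
    then have "(A *\<^sub>v unit_vec n j) $ i = (c \<cdot>\<^sub>v unit_vec n j) $ i" by (simp add: W_def)
    then show "A $$ (i, j) = (c \<cdot>\<^sub>m 1\<^sub>m n) $$ (i, j)"
      using ij A by auto
  qed (use A in auto)
  then show ?thesis by blast
qed

text \<open>Averaging the conjugates of \<open>A\<close> over the group produces a matrix to which
  \<open>schur\<close> applies. Each conjugate has the trace of \<open>A\<close>, and this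
  determines the scalar.\<close>

lemma average_conjugate_scalar:
  assumes A: "A \<in> carrier_mat n n"
  defines "S \<equiv> mat_sum n (carrier G) (\<lambda>g. \<rho> g * A * \<rho> (inv g))"
  shows "\<exists>c. S = c \<cdot>\<^sub>m 1\<^sub>m n \<and> of_nat n * c = of_nat (Coset.order G) * mat_trace A"
proof -
  have carr: "\<rho> g * A * \<rho> (inv g) \<in> carrier_mat n n" if "g \<in> carrier G" for g
    using that A rho_carrier[of g] rho_carrier[of "inv g"] by simp
  have "\<rho> h * S = S * \<rho> h" if h: "h \<in> carrier G" for h
  proof -
    have "\<rho> h * S = mat_sum n (carrier G) (\<lambda>g. \<rho> h * (\<rho> g * A * \<rho> (inv g)))"
      unfolding S_def using carr rho_carrier[OF h] by (rule mult_mat_sum[rotated])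
    also have "\<dots> = mat_sum n (carrier G) (\<lambda>g. \<rho> (h \<otimes> g) * A * \<rho> (inv (h \<otimes> g)) * \<rho> h)"
    proof -
      have "\<rho> h * (\<rho> g * A * \<rho> (inv g)) = \<rho> (h \<otimes> g) * A * \<rho> (inv (h \<otimes> g)) * \<rho> h"
        if g: "g \<in> carrier G" for g
      proof -
        note cs = rho_carrier[OF g] rho_carrier[OF h] rho_carrier[OF inv_closed[OF g]]
          rho_carrier[OF inv_closed[OF h]]
        have "\<rho> (inv (h \<otimes> g)) * \<rho> h = \<rho> (inv g) * (\<rho> (inv h) * \<rho> h)"
          using g h cs by (simp add: inv_mult_group rho_mult)
        also have "\<dots> = \<rho> (inv g)" using rho_inv(2)[OF h] cs by simp
        finally have "\<rho> (inv (h \<otimes> g)) * \<rho> h = \<rho> (inv g)" .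
        moreover have "\<rho> (inv (h \<otimes> g)) \<in> carrier_mat n n" using g h by (simp add: rho_carrier)
        ultimately show ?thesis
          using cs A g h
          by (simp add: rho_mult assoc_mult_mat[of _ n n _ n _ n])
      qed
      then show ?thesis unfolding mat_sum_def by (auto intro!: eq_matI sum.cong)
    qed
    \<comment> \<open>Reindexing by \<open>g \<mapsto> h \<otimes> g\<close> permutes the
      summands.\<close>
    also have "\<dots> = mat_sum n (carrier G) (\<lambda>g. \<rho> g * A * \<rho> (inv g) * \<rho> h)"
      unfolding mat_sum_def
      by (rule cong_mat) (auto intro: sum_mult_left[OF h, of "\<lambda>g. (\<rho> g * A * \<rho> (inv g) * \<rho> h) $$ ij" for ij])
    also have "\<dots> = S * \<rho> h"
      unfolding S_def using carr rho_carrier[OF h] by (rule mat_sum_mult[symmetric, rotated])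
    finally show ?thesis .
  qed
  then obtain c where c: "S = c \<cdot>\<^sub>m 1\<^sub>m n"
    using schur[of S] by (auto simp: S_def)
  have "of_nat n * c = mat_trace S" by (simp add: c mat_trace_smult_one)
  also have "\<dots> = (\<Sum>g\<in>carrier G. mat_trace (\<rho> g * A * \<rho> (inv g)))"
    unfolding S_def by (rule mat_trace_mat_sum[OF carr])
  also have "\<dots> = of_nat (Coset.order G) * mat_trace A"
    using A by (simp add: mat_trace_conjugate[of A n "\<rho> (inv g)" "\<rho> g" for g] rho_carrier rho_inv Coset.order_def)
  finally show ?thesis using c by blast
qed

text \<open>First orthogonality relation for a single character. Averaging a matrix unit isolates
  the products of diagonal entries of \<open>\<rho> g\<close> and \<open>\<rho> (inv g)\<close>, and
  \<open>\<rho> (inv g)\<close> has the conjugate trace.\<close>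

lemma character_norm_sum:
  "(\<Sum>g\<in>carrier G. (cmod (mat_trace (\<rho> g)))\<^sup>2) = Coset.order G"
proof -
  define E :: "nat \<Rightarrow> nat \<Rightarrow> complex mat" where
    "E i k = mat n n (\<lambda>(a, b). if a = i \<and> b = k then 1 else 0)" for i k
  have entry: "(\<rho> g * E i k * \<rho> (inv g)) $$ (i, k) = \<rho> g $$ (i, i) * \<rho> (inv g) $$ (k, k)"
    if g: "g \<in> carrier G" and ik: "i < n" "k < n" for g i k
  proof -
    have "(\<rho> g * E i k) $$ (i, b) = (if b = k then \<rho> g $$ (i, i) else 0)" if "b < n" for b
      using that ik rho_carrier[OF g]
      by (simp add: scalar_prod_def E_def if_distrib[of "\<lambda>x. _ * x"] sum.delta' cong: if_cong)
    then show ?thesis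
      using ik rho_carrier[OF g] rho_carrier[OF inv_closed[OF g]]
      by (simp add: scalar_prod_def E_def if_distrib[of "\<lambda>x. x * _"] cong: if_cong)
  qed
  \<comment> \<open>The average is a scalar matrix: its off-diagonal entries vanish, and for
    \<open>i = k\<close> the matrix unit has trace 1, so the scalar is the group order divided by
    \<open>n\<close>.\<close>
  have avg: "(\<Sum>g\<in>carrier G. \<rho> g $$ (i, i) * \<rho> (inv g) $$ (k, k)) = (if i = k then of_nat (Coset.order G) / of_nat n else 0)"
    if ik: "i < n" "k < n" for i k
  proof -
    obtain c where c: "mat_sum n (carrier G) (\<lambda>g. \<rho> g * E i k * \<rho> (inv g)) = c \<cdot>\<^sub>m 1\<^sub>m n"
      "of_nat n * c = of_nat (Coset.order G) * mat_trace (E i k)"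
      using average_conjugate_scalar[of "E i k"] by (auto simp: E_def)
    have "(\<Sum>g\<in>carrier G. \<rho> g $$ (i, i) * \<rho> (inv g) $$ (k, k)) = (c \<cdot>\<^sub>m 1\<^sub>m n) $$ (i, k)"
      using ik by (simp flip: c(1) add: entry)
    moreover have "mat_trace (E i i) = 1"
      using ik by (simp add: mat_trace_def E_def)
    ultimately show ?thesis
      using ik c(2) degree_pos by (auto simp: field_simps)
  qed
  have "(\<Sum>g\<in>carrier G. mat_trace (\<rho> g) * mat_trace (\<rho> (inv g)))
      = (\<Sum>g\<in>carrier G. \<Sum>i<n. \<Sum>k<n. \<rho> g $$ (i, i) * \<rho> (inv g) $$ (k, k))"
  proof (rule sum.cong[OF refl])
    fix g assume g: "g \<in> carrier G"
    show "mat_trace (\<rho> g) * mat_trace (\<rho> (inv g)) = (\<Sum>i<n. \<Sum>k<n. \<rho> g $$ (i, i) * \<rho> (inv g) $$ (k, k))"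
      using rho_carrier[OF g] rho_carrier[OF inv_closed[OF g]]
      by (simp add: mat_trace_def sum_product)
  qed
  also have "\<dots> = (\<Sum>i<n. \<Sum>k<n. \<Sum>g\<in>carrier G. \<rho> g $$ (i, i) * \<rho> (inv g) $$ (k, k))"
    by (subst sum.swap, rule sum.cong[OF refl], rule sum.swap)
  also have "\<dots> = of_nat (Coset.order G)"
    using degree_pos by (simp add: avg)
  finally have "(\<Sum>g\<in>carrier G. mat_trace (\<rho> g) * cnj (mat_trace (\<rho> g))) = of_nat (Coset.order G)"
    by (simp add: mat_trace_rho_inv)
  then have "complex_of_real (\<Sum>g\<in>carrier G. (cmod (mat_trace (\<rho> g)))\<^sup>2) = complex_of_real (Coset.order G)"
    by (simp add: complex_norm_square del: of_real_power)
  then show ?thesis using of_real_eq_iff by blast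
qed

text \<open>Equality in \<open>n\<^sup>2 |N| \<le> |G|\<close> would force the character to vanish off \<open>N\<close>, hence to have
  nonzero sum over \<open>G\<close>; but the sum of a nontrivial irreducible representation is zero.\<close>

lemma degree_square_less:
  assumes N: "N \<subset> carrier G" "N \<noteq> {}" and ker: "\<And>g. g \<in> N \<Longrightarrow> \<rho> g = 1\<^sub>m n"
  shows "n\<^sup>2 * card N < Coset.order G"
proof (rule ccontr)
  let ?\<chi> = "\<lambda>g. mat_trace (\<rho> g)"
  assume "\<not> ?thesis"
  then have ge: "real (Coset.order G) \<le> real (n\<^sup>2 * card N)" by linarith
  have finN: "finite N" using N finite_carrier finite_subset by blast
  have "(\<Sum>g\<in>carrier G. (cmod (?\<chi> g))\<^sup>2) = (\<Sum>g\<in>carrier G - N. (cmod (?\<chi> g))\<^sup>2) + (\<Sum>g\<in>N. (cmod (?\<chi> g))\<^sup>2)"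
    using N finite_carrier by (intro sum.subset_diff) auto
  also have "(\<Sum>g\<in>N. (cmod (?\<chi> g))\<^sup>2) = real (n\<^sup>2 * card N)"
    by (simp add: ker)
  finally have "(\<Sum>g\<in>carrier G - N. (cmod (?\<chi> g))\<^sup>2) \<le> 0"
    using ge character_norm_sum by simp
  then have "(\<Sum>g\<in>carrier G - N. (cmod (?\<chi> g))\<^sup>2) = 0"
    using sum_nonneg[of "carrier G - N" "\<lambda>g. (cmod (?\<chi> g))\<^sup>2"] by simp
  then have vanish: "?\<chi> g = 0" if "g \<in> carrier G - N" for g
    using that finite_carrier by (subst (asm) sum_nonneg_eq_0_iff) auto
  \<comment> \<open>The sum of all \<open>\<rho> g\<close> absorbs every \<open>\<rho> h\<close> on
    both sides, so it is a scalar \<open>c\<close>. Vanishing off \<open>N\<close> gives it the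
    nonzero trace \<open>n * card N\<close>; absorbing an \<open>h\<close> outside \<open>N\<close>
    then yields \<open>\<rho> h = 1\<^sub>m n\<close>, against the vanishing of the character at
    \<open>h\<close>.\<close>
  let ?S = "mat_sum n (carrier G) \<rho>"
  have left: "\<rho> h * ?S = ?S" if h: "h \<in> carrier G" for h
  proof -
    have "\<rho> h * ?S = mat_sum n (carrier G) (\<lambda>g. \<rho> h * \<rho> g)"
      using h by (intro mult_mat_sum rho_carrier)
    also have "\<dots> = ?S"
      unfolding mat_sum_def using sum_mult_left[OF h, of "\<lambda>g. \<rho> g $$ ij" for ij]
      by (intro cong_mat) (auto simp: h simp flip: rho_mult)
    finally show ?thesis .
  qed
  have right: "?S * \<rho> h = ?S" if h: "h \<in> carrier G" for h
  proof -
    have "?S * \<rho> h = mat_sum n (carrier G) (\<lambda>g. \<rho> g * \<rho> h)"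
      using h by (intro mat_sum_mult rho_carrier)
    also have "\<dots> = ?S"
      unfolding mat_sum_def using sum_mult_right[OF h, of "\<lambda>g. \<rho> g $$ ij" for ij]
      by (intro cong_mat) (auto simp: h simp flip: rho_mult)
    finally show ?thesis .
  qed
  obtain c where c: "?S = c \<cdot>\<^sub>m 1\<^sub>m n"
    using schur[of ?S] left right by auto
  have "of_nat n * c = mat_trace ?S" by (simp add: c mat_trace_smult_one)
  also have "\<dots> = (\<Sum>g\<in>carrier G. ?\<chi> g)" by (rule mat_trace_mat_sum[OF rho_carrier])
  also have "\<dots> = (\<Sum>g\<in>N. ?\<chi> g)"
    using N finite_carrier vanish by (intro sum.mono_neutral_right) auto
  also have "\<dots> = of_nat (n * card N)" by (simp add: ker)
  finally have "c \<noteq> 0" using degree_pos N finN by (auto simp: card_gt_0_iff)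
  obtain h where h: "h \<in> carrier G" "h \<notin> N" using N by blast
  have "c \<cdot>\<^sub>m \<rho> h = c \<cdot>\<^sub>m 1\<^sub>m n"
    using left[OF h(1)] c smult_one_commute(2)[OF rho_carrier[OF h(1)], of c] by simp
  then have "c * mat_trace (\<rho> h) = c * of_nat n"
    using mat_trace_smult[of "\<rho> h" n c] rho_carrier[OF h(1)] by (auto simp: mat_trace_smult_one)
  then show False using vanish[of h] h \<open>c \<noteq> 0\<close> degree_pos by simp
qed

end

section \<open>Reduction along invariant subspaces\<close>

text \<open>The columns of \<open>P\<close> are a basis of the whole space that lists a basis of
  \<open>W\<close> first, and its inverse \<open>Q\<close> reads off coordinates. Both bases arise
  as maximal independent sets, whose size is bounded by \<open>n\<close>.\<close>

lemma subspace_adapted_basis: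
  fixes W :: "'a :: field vec set"
  assumes W: "subspace class_ring W (module_vec TYPE('a) n)"
    and nontriv: "W \<noteq> {0\<^sub>v n}" "W \<noteq> carrier_vec n"
  obtains P Q k where "P \<in> carrier_mat n n" "Q \<in> carrier_mat n n" "P * Q = 1\<^sub>m n" "Q * P = 1\<^sub>m n"
    "0 < k" "k < n" "\<And>j. j < k \<Longrightarrow> col P j \<in> W"
    "\<And>w i. w \<in> W \<Longrightarrow> k \<le> i \<Longrightarrow> i < n \<Longrightarrow> (Q *\<^sub>v w) $ i = 0"
proof -
  interpret vec_space "TYPE('a)" n .
  have subm: "submodule class_ring W V" using W by (simp add: subspace_def)
  have Wc: "W \<subseteq> carrier_vec n" using submodule.subset[OF subm] by simp
  have bound: "finite S \<and> card S \<le> n" if "S \<subseteq> carrier_vec n" "lin_indpt S" for S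
    using li_le_dim[OF fin_dim] that by (simp add: dim_is_n)
  have "lin_indpt {}" by (simp add: lin_dep_def)
  then obtain B where maxB: "maximal B (\<lambda>S. S \<subseteq> W \<and> lin_indpt S)"
    using maximal_exists[of "\<lambda>S. S \<subseteq> W \<and> lin_indpt S" n "{}"] bound Wc
    by (meson empty_subsetI subset_trans)
  then have B: "B \<subseteq> W" "lin_indpt B" by (auto simp: maximal_def)
  have Bc: "B \<subseteq> carrier_vec n" using B Wc by blast
  have finB: "finite B" using bound[OF Bc B(2)] by simp
  have WB: "w \<in> span B" if w: "w \<in> W" for w
  proof (cases "w \<in> B")
    case True
    then show ?thesis using in_own_span[of B] Bc by auto
  next
    case False
    show ?thesis
    proof (rule ccontr)
      assume "w \<notin> span B"
      then have "lin_indpt (B \<union> {w})"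
        using lin_dep_iff_in_span[of B w] B(2) Bc w Wc False by auto
      moreover have "B \<union> {w} \<subseteq> W" using B w by simp
      ultimately show False using maxB False unfolding maximal_def by blast
    qed
  qed
  obtain C where maxC: "maximal C (\<lambda>S. B \<subseteq> S \<and> S \<subseteq> carrier_vec n \<and> lin_indpt S)"
    using maximal_exists[of "\<lambda>S. B \<subseteq> S \<and> S \<subseteq> carrier_vec n \<and> lin_indpt S" n B] bound B Bc
    by (meson order_refl)
  then have C: "B \<subseteq> C" "C \<subseteq> carrier_vec n" "lin_indpt C" by (auto simp: maximal_def)
  have finC: "finite C" using bound[OF C(2,3)] by simp
  \<comment> \<open>Any independent set above \<open>C\<close> also contains \<open>B\<close>, so
    maximality among the extensions of \<open>B\<close> is maximality outright, and \<open>C\<close>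
    is a basis.\<close>
  have "maximal C (\<lambda>S. S \<subseteq> carrier_vec n \<and> lin_indpt S)"
    unfolding maximal_def
  proof (intro conjI allI impI)
    fix S assume S: "C \<subseteq> S \<and> S \<subseteq> carrier_vec n \<and> lin_indpt S"
    then have "B \<subseteq> S" using C(1) by blast
    with S maxC show "S = C" unfolding maximal_def by blast
  qed (use C in auto)
  then have basisC: "basis C" using max_li_is_basis[of C] by simp
  have cardC: "card C = n" using dim_basis[OF finC basisC] dim_is_n by simp
  obtain bs cs where bs: "distinct bs" "set bs = B" and cs: "distinct cs" "set cs = C - B"
    using finB finC finite_distinct_list by (metis finite_Diff)
  define ws where "ws = bs @ cs"
  define k where "k = card B"
  have ws: "distinct ws" "set ws = C"
    using bs cs C(1) by (auto simp: ws_def)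
  then have lws: "length ws = n" using cardC distinct_card[of ws] by simp
  have lbs: "length bs = k" using bs distinct_card[of bs] by (simp add: k_def)
  define P where "P = mat_of_cols n ws"
  have P: "P \<in> carrier_mat n n" using lws by (auto simp: P_def)
  have cols: "cols P = ws" using ws lws C(2) by (simp add: P_def)
  have col: "col P i = ws ! i" if "i < n" for i
    using that ws lws C(2) nth_mem[of i ws] by (auto simp: P_def)
  have "rank P = n" using lin_indpt_full_rank[OF P] cols ws C(3) by simp
  then have "det P \<noteq> 0" using det_rank_iff[OF P] by simp
  then obtain Q where Q: "Q \<in> carrier_mat n n" "P * Q = 1\<^sub>m n" "Q * P = 1\<^sub>m n"
    using det_non_zero_imp_unit[OF P] by (auto simp: Units_def ring_mat_simps)
  have vanish: "(Q *\<^sub>v w) $ i = 0" if w: "w \<in> W" and i: "k \<le> i" "i < n" for w i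
  proof -
    obtain a where a: "w = lincomb a B"
      using finite_in_span[OF finB, of w] Bc WB[OF w] by auto
    \<comment> \<open>Extended by zero, the coefficients of \<open>w\<close> over \<open>B\<close>
      become its coordinates over \<open>C\<close>; they vanish at every column after the first
      \<open>k\<close>.\<close>
    define a' where "a' v = (if v \<in> B then a v else 0)" for v
    have "lincomb a' C = w"
    proof (rule eq_vecI)
      fix i assume "i < dim_vec w"
      then have i: "i < n" using w Wc by auto
      have "lincomb a' C $ i = (\<Sum>x\<in>C. a' x * x $ i)" by (rule lincomb_index[OF i C(2)])
      also have "\<dots> = (\<Sum>x\<in>B. a x * x $ i)"
        using finC C(1) by (intro sum.mono_neutral_cong_right) (auto simp: a'_def)
      also have "\<dots> = w $ i" using a lincomb_index[OF i Bc] by simp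
      finally show "lincomb a' C $ i = w $ i" .
    qed (use w Wc lincomb_dim[OF finC C(2)] in auto)
    then have "w = P *\<^sub>v vec n (\<lambda>i. a' (col P i))"
      using mat_mult_eq_lincomb[OF P, of a'] cols ws by simp
    then have "Q *\<^sub>v w = (Q * P) *\<^sub>v vec n (\<lambda>i. a' (col P i))"
      using P Q(1) by (metis assoc_mult_mat_vec vec_carrier)
    then have "(Q *\<^sub>v w) $ i = a' (col P i)" using Q i by simp
    moreover have "ws ! i \<notin> B"
      using i lbs cs ws lws nth_mem[of "i - k" cs] by (auto simp: ws_def nth_append)
    ultimately show ?thesis using col i by (simp add: a'_def)
  qed
  have k_le: "k \<le> n" using lbs lws by (simp add: ws_def)
  have colW: "col P j \<in> W" if "j < k" for j
    using that B(1) bs lbs lws k_le col[of j] nth_mem[of j bs] by (auto simp: ws_def nth_append)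
  have "k > 0"
  proof (rule ccontr)
    assume "\<not> k > 0"
    then have "B = {}" using finB by (simp add: k_def)
    then have "W \<subseteq> {0\<^sub>v n}" using WB span_empty by auto
    moreover have "0\<^sub>v n \<in> W" using submodule.zero_closed[OF subm] by simp
    ultimately show False using nontriv by blast
  qed
  moreover have "k < n"
  proof (rule ccontr)
    assume "\<not> k < n"
    then have "B = C" using C(1) finC cardC card_seteq[of C B] by (simp add: k_def)
    then have "carrier_vec n = span B" using basisC by (simp add: basis_def)
    also have "\<dots> \<subseteq> W" by (rule span_is_subset[OF B(1) subm])
    finally show False using nontriv Wc by blast
  qed
  ultimately show thesis using that P Q vanish colW by blast
qed

text \<open>In a basis adapted to \<open>W\<close> all matrices are block upper triangular. The
  diagonal blocks \<open>A\<close> and \<open>D\<close> are the actions on \<open>W\<close> and on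
  the quotient by \<open>W\<close>, and they retain the trace.\<close>

lemma reducible_representation_split:
  assumes "finite_group_representation G n \<rho>"
    and inv: "invariant_subspace G n \<rho> W" and nontriv: "W \<noteq> {0\<^sub>v n}" "W \<noteq> carrier_vec n"
  obtains k A D where "0 < k" "k < n" "representation G k A" "representation G (n - k) D"
    "\<And>g. g \<in> carrier G \<Longrightarrow> mat_trace (\<rho> g) = mat_trace (A g) + mat_trace (D g)"
    "\<And>g. g \<in> carrier G \<Longrightarrow> \<rho> g = 1\<^sub>m n \<Longrightarrow> A g = 1\<^sub>m k \<and> D g = 1\<^sub>m (n - k)"
proof -
  interpret finite_group_representation G n \<rho> by fact
  obtain P Q k where P: "P \<in> carrier_mat n n" and Q: "Q \<in> carrier_mat n n"
    and PQ: "P * Q = 1\<^sub>m n" and QP: "Q * P = 1\<^sub>m n" and k: "0 < k" "k < n"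
    and col: "\<And>j. j < k \<Longrightarrow> col P j \<in> W"
    and van: "\<And>w i. w \<in> W \<Longrightarrow> k \<le> i \<Longrightarrow> i < n \<Longrightarrow> (Q *\<^sub>v w) $ i = 0"
    using subspace_adapted_basis[of W n] inv nontriv unfolding invariant_subspace_def by metis
  define M where "M g = Q * \<rho> g * P" for g
  have Mc: "M g \<in> carrier_mat n n" if "g \<in> carrier G" for g
    using P Q rho_carrier[OF that] by (simp add: M_def)
  have M1: "M g = 1\<^sub>m n" if "\<rho> g = 1\<^sub>m n" for g
    using that Q QP by (simp add: M_def)
  have Mmult: "M (g \<otimes>\<^bsub>G\<^esub> h) = M g * M h" if g: "g \<in> carrier G" and h: "h \<in> carrier G" for g h
  proof -
    note r = rho_carrier[OF g] rho_carrier[OF h]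
    have "M g * M h = Q * \<rho> g * (P * (Q * (\<rho> h * P)))"
      using P Q r by (simp add: M_def assoc_mult_mat[of _ n n _ n _ n])
    also have "P * (Q * (\<rho> h * P)) = \<rho> h * P"
      using P Q r PQ by (simp flip: assoc_mult_mat[of P n n Q n _ n])
    also have "Q * \<rho> g * (\<rho> h * P) = M (g \<otimes>\<^bsub>G\<^esub> h)"
      using P Q r by (simp add: M_def rho_mult[OF g h] assoc_mult_mat[of _ n n _ n _ n])
    finally show ?thesis by simp
  qed
  \<comment> \<open>The lower left block is zero: column \<open>j < k\<close> of \<open>P\<close>
    lies in \<open>W\<close>, its image stays in \<open>W\<close>, and vectors of \<open>W\<close>
    have no coordinates from \<open>k\<close> on.\<close>
  have Mzero: "M g $$ (i, j) = 0" if g: "g \<in> carrier G" and ij: "k \<le> i" "i < n" "j < k" for g i j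
  proof -
    have "\<rho> g *\<^sub>v col P j \<in> W"
      using inv g col[OF ij(3)] by (simp add: invariant_subspace_def)
    then have "(Q *\<^sub>v (\<rho> g *\<^sub>v col P j)) $ i = 0" using van ij by blast
    moreover have "Q *\<^sub>v (\<rho> g *\<^sub>v col P j) = col (M g) j"
      unfolding M_def
      using P Q rho_carrier[OF g] ij k assoc_mult_mat_vec[of Q n n "\<rho> g" n "col P j"]
        col_mult2[of "Q * \<rho> g" n n P n j] col_carrier_vec[of j n P n] by simp
    ultimately show ?thesis using Mc[OF g] ij k by simp
  qed
  define A where "A g = mat k k (\<lambda>(i, j). M g $$ (i, j))" for g
  define D where "D g = mat (n - k) (n - k) (\<lambda>(i, j). M g $$ (i + k, j + k))" for g
  have split: "(\<Sum>l = 0..<n. f l) = (\<Sum>l = 0..<k. f l) + (\<Sum>l = 0..<n - k. f (l + k))"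
    for f :: "nat \<Rightarrow> complex"
  proof -
    have "(\<Sum>l = 0..<n. f l) = (\<Sum>l = 0..<k. f l) + (\<Sum>l = k..<n. f l)"
      using k by (intro sum.atLeastLessThan_concat[symmetric]) auto
    also have "(\<Sum>l = k..<n. f l) = (\<Sum>l = 0..<n - k. f (l + k))"
      using sum.shift_bounds_nat_ivl[of f 0 k "n - k"] k by simp
    finally show ?thesis .
  qed
  have Mindex: "M (g \<otimes>\<^bsub>G\<^esub> h) $$ (i, j) = (\<Sum>l = 0..<k. M g $$ (i, l) * M h $$ (l, j))
      + (\<Sum>l = 0..<n - k. M g $$ (i, l + k) * M h $$ (l + k, j))"
    if "g \<in> carrier G" "h \<in> carrier G" "i < n" "j < n" for g h i j
    using that Mc[of g] Mc[of h] by (simp add: Mmult scalar_prod_def split)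
  have one: "A g = 1\<^sub>m k \<and> D g = 1\<^sub>m (n - k)" if "\<rho> g = 1\<^sub>m n" for g
    using M1[OF that] k by (auto simp: A_def D_def intro!: eq_matI)
  have "representation G k A"
    unfolding representation_iff
  proof (intro conjI ballI)
    fix g h assume gh: "g \<in> carrier G" "h \<in> carrier G"
    show "A (g \<otimes>\<^bsub>G\<^esub> h) = A g * A h"
      using k gh by (intro eq_matI) (auto simp: A_def Mindex Mzero scalar_prod_def)
  qed (use one rho_one in \<open>auto simp: A_def\<close>)
  moreover have "representation G (n - k) D"
    unfolding representation_iff
  proof (intro conjI ballI)
    fix g h assume gh: "g \<in> carrier G" "h \<in> carrier G"
    show "D (g \<otimes>\<^bsub>G\<^esub> h) = D g * D h"
      using k gh by (intro eq_matI) (auto simp: D_def Mindex Mzero scalar_prod_def)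
  qed (use one rho_one in \<open>auto simp: D_def\<close>)
  moreover have "mat_trace (\<rho> g) = mat_trace (A g) + mat_trace (D g)" if g: "g \<in> carrier G" for g
  proof -
    have "mat_trace (\<rho> g) = mat_trace (M g)"
      unfolding M_def using mat_trace_conjugate[OF rho_carrier[OF g] P Q PQ] by simp
    also have "\<dots> = (\<Sum>l = 0..<n. M g $$ (l, l))"
      using Mc[OF g] by (simp add: mat_trace_def lessThan_atLeast0)
    also have "\<dots> = mat_trace (A g) + mat_trace (D g)"
      unfolding split by (simp add: mat_trace_def A_def D_def lessThan_atLeast0)
    finally show ?thesis .
  qed
  ultimately show thesis using that k one by blast
qed

text \<open>The conclusion concerns the trace and not \<open>\<rho> h\<close> itself: traces of
  diagonal blocks add up, whereas identity diagonal blocks say nothing about the block above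
  them.\<close>

lemma mat_trace_eq_degree_by_irreducibles:
  assumes G: "group G" "finite (carrier G)" and h: "h \<in> carrier G" and N: "N \<subseteq> carrier G"
    and irr: "\<And>m \<psi>. irreducible_representation G m \<psi> \<Longrightarrow> (\<And>z. z \<in> N \<Longrightarrow> \<psi> z = 1\<^sub>m m) \<Longrightarrow>
      mat_trace (\<psi> h) = of_nat m"
  shows "representation G n \<rho> \<Longrightarrow> (\<And>z. z \<in> N \<Longrightarrow> \<rho> z = 1\<^sub>m n) \<Longrightarrow> mat_trace (\<rho> h) = of_nat n"
proof (induction n arbitrary: \<rho> rule: less_induct)
  case (less n)
  interpret finite_group_representation G n \<rho>
    using G less.prems(1)
    by (intro finite_group_representation.intro finite_group_representation_axioms.intro)
  consider "n = 0" | "irreducible_representation G n \<rho>"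
    | W where "invariant_subspace G n \<rho> W" "W \<noteq> {0\<^sub>v n}" "W \<noteq> carrier_vec n"
    using less.prems(1) by (auto simp: irreducible_representation_def)
  then show ?case
  proof cases
    case 1
    then show ?thesis using rho_carrier[OF h] by (simp add: mat_trace_def)
  next
    case 2
    then show ?thesis using irr less.prems(2) by blast
  next
    case 3
    obtain k A D where k: "0 < k" "k < n" and AD: "representation G k A" "representation G (n - k) D"
      and tr: "\<And>g. g \<in> carrier G \<Longrightarrow> mat_trace (\<rho> g) = mat_trace (A g) + mat_trace (D g)"
      and one: "\<And>g. g \<in> carrier G \<Longrightarrow> \<rho> g = 1\<^sub>m n \<Longrightarrow> A g = 1\<^sub>m k \<and> D g = 1\<^sub>m (n - k)"
      using reducible_representation_split[OF finite_group_representation_axioms 3] by metis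
    have "mat_trace (A h) = of_nat k" "mat_trace (D h) = of_nat (n - k)"
      using less.IH[OF _ AD(1)] less.IH[OF _ AD(2)] k one N less.prems(2) by (auto simp: subset_iff)
    then show ?thesis using tr[OF h] k by (simp flip: of_nat_add)
  qed
qed

section \<open>The permutation representation on cosets\<close>

text \<open>\<open>G\<close> permutes the cosets of \<open>N\<close>, and the trace counts fixed
  cosets. Full trace means that the coset \<open>N\<close> itself is fixed, which puts
  \<open>g\<close> into \<open>N\<close>.\<close>

lemma coset_representation:
  fixes G :: "('a, 'b) monoid_scheme" (structure)
  assumes "N \<lhd> G" "finite (carrier G)"
  obtains m \<psi> where "representation G m \<psi>" "\<And>z. z \<in> N \<Longrightarrow> \<psi> z = 1\<^sub>m m"
    "\<And>g. g \<in> carrier G \<Longrightarrow> mat_trace (\<psi> g) = of_nat m \<Longrightarrow> g \<in> N"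
proof -
  interpret normal N G by fact
  have sub: "subgroup N G" by (rule is_subgroup)
  define m where "m = card (rcosets N)"
  have fin: "finite (rcosets N)"
    using assms(2) rcosets_subset_PowG[OF sub] by (meson finite_Pow_iff finite_subset)
  obtain C where C: "bij_betw C {0..<m} (rcosets N)"
    using ex_bij_betw_nat_finite[OF fin] unfolding m_def by blast
  have Cin: "C i \<in> rcosets N" if "i < m" for i
    using C that by (auto simp: bij_betw_def)
  have Cinj: "C i = C j \<longleftrightarrow> i = j" if "i < m" "j < m" for i j
    using C that by (auto simp: bij_betw_def inj_on_def)
  have act: "c #> g \<in> rcosets N" if "c \<in> rcosets N" "g \<in> carrier G" for c g
    using that by (auto simp: RCOSETS_def coset_mult_assoc subset)
  have actN: "c #> inv z = c" if c: "c \<in> rcosets N" and z: "z \<in> N" for c z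
  proof -
    obtain x where x: "x \<in> carrier G" "c = N #> x" using c by (auto simp: RCOSETS_def)
    have zc: "z \<in> carrier G" using z subset by blast
    \<comment> \<open>By normality \<open>x \<otimes> inv z \<otimes> inv x\<close> lies in
      \<open>N\<close>, so the coset absorbs it.\<close>
    have "c #> inv z = N #> (x \<otimes> inv z \<otimes> inv x \<otimes> x)"
      using x zc by (simp add: coset_mult_assoc subset m_assoc)
    also have "\<dots> = N #> (x \<otimes> inv z \<otimes> inv x) #> x"
      using x zc by (simp add: coset_mult_assoc subset)
    also have "N #> (x \<otimes> inv z \<otimes> inv x) = N"
      using x z zc sub by (intro coset_join2) (auto intro: inv_op_closed2)
    finally show ?thesis using x by simp
  qed
  \<comment> \<open>The inverse turns right multiplication of cosets into a left action, as a
    homomorphism into matrices acting on column vectors requires.\<close>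
  define \<psi> :: "'a \<Rightarrow> complex mat" where
    "\<psi> g = mat m m (\<lambda>(i, j). if C i = C j #> inv g then 1 else 0)" for g
  have ker: "\<psi> z = 1\<^sub>m m" if "z \<in> N" for z
    using that Cin Cinj actN by (intro eq_matI) (auto simp: \<psi>_def)
  have "\<psi> (g \<otimes> h) = \<psi> g * \<psi> h" if g: "g \<in> carrier G" and h: "h \<in> carrier G" for g h
  proof (rule eq_matI)
    fix i j assume "i < dim_row (\<psi> g * \<psi> h)" "j < dim_col (\<psi> g * \<psi> h)"
    then have ij: "i < m" "j < m" by (auto simp: \<psi>_def)
    have cj: "C j \<subseteq> carrier G" using rcosets_carrier[OF is_group Cin[OF ij(2)]] .
    have "C j #> inv h \<in> C ` {0..<m}"
      using C act[OF Cin[OF ij(2)] inv_closed[OF h]] by (simp add: bij_betw_def)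
    then obtain l where l: "l < m" "C l = C j #> inv h" by (metis imageE atLeastLessThan_iff)
    have "(\<psi> g * \<psi> h) $$ (i, j) = (\<Sum>l' = 0..<m. \<psi> g $$ (i, l') * \<psi> h $$ (l', j))"
      using ij by (simp add: \<psi>_def scalar_prod_def)
    \<comment> \<open>Column \<open>j\<close> of \<open>\<psi> h\<close> has a single nonzero entry,
      in the row \<open>l\<close> of the coset to which \<open>h\<close> moves
      \<open>C j\<close>.\<close>
    also have "\<dots> = (\<Sum>l' = 0..<m. if l' = l then \<psi> g $$ (i, l) else 0)"
      using ij l Cinj[OF _ l(1)] by (intro sum.cong) (auto simp: \<psi>_def)
    also have "\<dots> = \<psi> g $$ (i, l)" using l by simp
    also have "\<dots> = \<psi> (g \<otimes> h) $$ (i, j)"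
      using ij l g h cj by (simp add: \<psi>_def coset_mult_assoc inv_mult_group)
    finally show "\<psi> (g \<otimes> h) $$ (i, j) = (\<psi> g * \<psi> h) $$ (i, j)" by simp
  qed (auto simp: \<psi>_def)
  then have rep: "representation G m \<psi>"
    unfolding representation_iff using ker[OF subgroup.one_closed[OF sub]] by (auto simp: \<psi>_def)
  have faithful: "g \<in> N" if g: "g \<in> carrier G" and tr: "mat_trace (\<psi> g) = of_nat m" for g
  proof -
    let ?F = "{i. i < m \<and> C i = C i #> inv g}"
    have "mat_trace (\<psi> g) = of_nat (card ?F)"
      by (simp add: mat_trace_def \<psi>_def sum.If_cases) (simp add: Int_def)
    then have "card ?F = m" using tr by simp
    then have F: "?F = {..<m}"
      using card_subset_eq[of "{..<m}" ?F] by auto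
    have "N \<in> C ` {0..<m}"
      using C subgroup_in_rcosets[OF is_group] by (simp add: bij_betw_def)
    then obtain i where i: "i < m" "C i = N" by (metis imageE atLeastLessThan_iff)
    then have "N #> inv g = N" using F by auto
    then have "inv g \<in> N" using coset_join1[of N "inv g"] sub g subset by simp
    then show ?thesis using g m_inv_closed by fastforce
  qed
  show thesis using that rep ker faithful by blast
qed

text \<open>This is the statement that the irreducible representations of the quotient by
  \<open>N\<close> separate its elements from the identity, phrased inside \<open>G\<close>.\<close>

lemma normal_subgroup_eq_kernels:
  assumes N: "N \<lhd> G" and fin: "finite (carrier G)" and h: "h \<in> carrier G"
    and irr: "\<And>m \<psi>. irreducible_representation G m \<psi> \<Longrightarrow> (\<And>z. z \<in> N \<Longrightarrow> \<psi> z = 1\<^sub>m m) \<Longrightarrow>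
      \<psi> h = 1\<^sub>m m"
  shows "h \<in> N"
proof -
  interpret normal N G by fact
  obtain m \<psi> where \<psi>: "representation G m \<psi>" "\<And>z. z \<in> N \<Longrightarrow> \<psi> z = 1\<^sub>m m"
    and faithful: "\<And>g. g \<in> carrier G \<Longrightarrow> mat_trace (\<psi> g) = of_nat m \<Longrightarrow> g \<in> N"
    using coset_representation[OF N fin] by blast
  have "mat_trace (\<psi> h) = of_nat m"
    by (rule mat_trace_eq_degree_by_irreducibles[OF is_group fin h subset _ \<psi>]) (simp_all add: irr)
  then show ?thesis by (rule faithful[OF h])
qed

section \<open>The lower central series\<close>

context group
begin

lemma commutator_subgroup_mono:
  "H \<subseteq> H' \<Longrightarrow> commutator_subgroup G H K \<subseteq> commutator_subgroup G H' K"
  unfolding commutator_subgroup_def by (rule mono_generate) blast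

lemma commutator_subgroup_subset:
  assumes "subgroup L G" "\<And>h k. h \<in> H \<Longrightarrow> k \<in> K \<Longrightarrow> h \<otimes> k \<otimes> inv h \<otimes> inv k \<in> L"
  shows "commutator_subgroup G H K \<subseteq> L"
  unfolding commutator_subgroup_def using assms by (intro generate_subgroup_incl) auto

lemma lower_central_series_carrier: "lower_central_series G i \<subseteq> carrier G"
proof (induction i)
  case (Suc i)
  then show ?case
    unfolding lower_central_series.simps by (intro commutator_subgroup_subset subgroup_self) auto
qed simp

lemma one_in_lower_central_series: "\<one> \<in> lower_central_series G i"
  by (cases i) (auto simp: commutator_subgroup_def intro: generate.one)

text \<open>Taking commutators with \<open>G\<close> is monotone, so an inclusion of consecutive
  terms propagates down the series from the trivial one at the top.\<close>

lemma lower_central_series_Suc_subset: "lower_central_series G (Suc i) \<subseteq> lower_central_series G i"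
proof (induction i)
  case 0
  show ?case using lower_central_series_carrier[of 1] by simp
next
  case (Suc i)
  then show ?case using commutator_subgroup_mono by (metis lower_central_series.simps(2))
qed

lemma lower_central_series_antimono:
  "i \<le> j \<Longrightarrow> lower_central_series G j \<subseteq> lower_central_series G i"
  by (rule lift_Suc_antimono_le[of "lower_central_series G", OF lower_central_series_Suc_subset])

end

section \<open>The class bound\<close>

text \<open>The elements of \<open>cd G\<close> are complex numbers; natural numbers allow induction
  on the degree and counting the degrees up to a bound.\<close>

definition irreducible_degrees :: "('a, 'b) monoid_scheme \<Rightarrow> nat set" where
  "irreducible_degrees G = {n. \<exists>\<rho>. irreducible_representation G n \<rho>}"

lemma finite_group_irrepI:
  "group G \<Longrightarrow> finite (carrier G) \<Longrightarrow> irreducible_representation G n \<rho> \<Longrightarrow> finite_group_irrep G n \<rho>"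
  by (intro finite_group_irrep.intro finite_group_irrep_axioms.intro)

text \<open>The summand at the identity in \<open>character_norm_sum\<close> is the square of the
  degree, so it is at most the group order.\<close>

lemma finite_irreducible_degrees:
  assumes "group G" "finite (carrier G)"
  shows "finite (irreducible_degrees G)"
proof (rule finite_subset)
  show "irreducible_degrees G \<subseteq> {..Coset.order G}"
  proof
    fix n assume "n \<in> irreducible_degrees G"
    then obtain \<rho> where "irreducible_representation G n \<rho>" by (auto simp: irreducible_degrees_def)
    then interpret finite_group_irrep G n \<rho> by (rule finite_group_irrepI[OF assms])
    have "(cmod (mat_trace (\<rho> \<one>\<^bsub>G\<^esub>)))\<^sup>2 \<le> Coset.order G"
      unfolding character_norm_sum[symmetric] using assms(2) by (intro member_le_sum) auto
    then have "real (n\<^sup>2) \<le> real (Coset.order G)" by (simp add: rho_one)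
    then have "n\<^sup>2 \<le> Coset.order G" by (simp only: of_nat_le_iff)
    moreover have "n \<le> n\<^sup>2" by (simp add: power2_eq_square)
    ultimately show "n \<in> {..Coset.order G}" by simp
  qed
qed simp

lemma cd_eq_irreducible_degrees:
  assumes "group G" "finite (carrier G)"
  shows "cd G = of_nat ` irreducible_degrees G"
proof -
  have one: "character_of G \<rho> \<one>\<^bsub>G\<^esub> = of_nat n" if "irreducible_representation G n \<rho>" for n \<rho>
  proof -
    interpret finite_group_irrep G n \<rho> by (rule finite_group_irrepI[OF assms that])
    show ?thesis by (rule character_one)
  qed
  show ?thesis
  proof (intro equalityI subsetI)
    fix x assume "x \<in> cd G"
    then obtain n \<rho> where "irreducible_representation G n \<rho>" "x = character_of G \<rho> \<one>\<^bsub>G\<^esub>"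
      by (auto simp: cd_def Irr_def)
    then show "x \<in> of_nat ` irreducible_degrees G"
      using one by (auto simp: irreducible_degrees_def)
  next
    fix x :: complex assume "x \<in> of_nat ` irreducible_degrees G"
    then obtain n \<rho> where n: "irreducible_representation G n \<rho>" "x = of_nat n"
      by (auto simp: irreducible_degrees_def)
    then have "x = character_of G \<rho> \<one>\<^bsub>G\<^esub>" using one by simp
    then show "x \<in> cd G" unfolding cd_def Irr_def using n(1) by blast
  qed
qed

text \<open>Squaring the defining equation and multiplying by the order of the centre (Lagrange)
  gives the form that compares directly with \<open>degree_square_less\<close>.\<close>

lemma GVZ_group_degree:
  assumes "GVZ_group G" "irreducible_representation G n \<rho>"
  shows "n\<^sup>2 * card (character_center G (character_of G \<rho>)) = Coset.order G"
proof -
  let ?\<chi> = "character_of G \<rho>"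
  interpret finite_group_irrep G n \<rho>
    using assms by (intro finite_group_irrepI) (auto simp: GVZ_group_def)
  have "?\<chi> \<in> Irr G" using assms(2) by (auto simp: Irr_def)
  then have "complex_of_real (real n) = complex_of_real (sqrt (subgroup_index G (character_center G ?\<chi>)))"
    using assms(1) character_one by (auto simp: GVZ_group_def)
  then have "real n = sqrt (subgroup_index G (character_center G ?\<chi>))"
    by (simp only: of_real_eq_iff)
  then have "real (n\<^sup>2) = real (subgroup_index G (character_center G ?\<chi>))" by simp
  then have "n\<^sup>2 = subgroup_index G (character_center G ?\<chi>)" by (simp only: of_nat_eq_iff)
  then show ?thesis
    using lagrange[OF normal_imp_subgroup[OF character_center_normal]]
    by (simp add: subgroup_index_def)
qed

text \<open>The index counts only degrees that occur, \<open>n\<close> included. For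
  \<open>n = 1\<close> it is 1, and with the series starting at 0 this is the derived
  subgroup.\<close>

lemma GVZ_lower_central_series_kernel:
  assumes GVZ: "GVZ_group G"
  shows "irreducible_representation G n \<rho> \<Longrightarrow>
    g \<in> lower_central_series G (card {d \<in> irreducible_degrees G. d \<le> n}) \<Longrightarrow> \<rho> g = 1\<^sub>m n"
proof (induction n arbitrary: \<rho> g rule: less_induct)
  case (less n)
  let ?D = "\<lambda>n. {d \<in> irreducible_degrees G. d \<le> n}"
  let ?Z = "character_center G (character_of G \<rho>)"
  have G: "group G" "finite (carrier G)" using GVZ by (auto simp: GVZ_group_def)
  interpret finite_group_irrep G n \<rho> by (rule finite_group_irrepI[OF G less.prems(1)])
  have fin: "finite (?D k)" for k using finite_irreducible_degrees[OF G] by simp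
  have nD: "n \<in> ?D n" using less.prems(1) by (auto simp: irreducible_degrees_def)
  then have "card (?D n) > 0" using fin card_gt_0_iff by blast
  then obtain s where s: "card (?D n) = Suc s" by (metis Suc_diff_1)
  have Z: "?Z \<lhd> G" by (rule character_center_normal)
  have Zc: "?Z \<subseteq> carrier G" "?Z \<noteq> {}"
    using normal_imp_subgroup[OF Z] subgroup.subset subgroup.one_closed by (blast, blast)
  have "lower_central_series G s \<subseteq> ?Z"
  \<comment> \<open>\<open>degree_square_less\<close> applies to proper subsets only; when the
    centre is everything, the inclusion is immediate.\<close>
  proof (cases "?Z = carrier G")
    case True
    then show ?thesis using lower_central_series_carrier by simp
  next
    case False
    show ?thesis
    proof
      fix x assume x: "x \<in> lower_central_series G s"
      show "x \<in> ?Z"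
      proof (rule normal_subgroup_eq_kernels[OF Z G(2)])
        show "x \<in> carrier G" using x lower_central_series_carrier by blast
        fix m \<psi> assume \<psi>: "irreducible_representation G m \<psi>" and ker: "\<And>z. z \<in> ?Z \<Longrightarrow> \<psi> z = 1\<^sub>m m"
        interpret psi: finite_group_irrep G m \<psi> by (rule finite_group_irrepI[OF G \<psi>])
        have "?Z \<subset> carrier G" using False Zc(1) by blast
        then have "m\<^sup>2 * card ?Z < n\<^sup>2 * card ?Z"
          using psi.degree_square_less[OF _ Zc(2) ker] GVZ_group_degree[OF GVZ less.prems(1)] by simp
        then have "m\<^sup>2 < n\<^sup>2" by simp
        then have "m < n" by (rule power_less_imp_less_base) simp
        \<comment> \<open>The degree \<open>n\<close> is counted in \<open>?D n\<close> but not in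
          \<open>?D m\<close>; this gains the one step that the commutator with \<open>G\<close>
          uses up afterwards.\<close>
        then have "?D m \<subseteq> ?D n" "n \<notin> ?D m" by auto
        then have "?D m \<subset> ?D n" using nD by blast
        then have "card (?D m) < card (?D n)" by (rule psubset_card_mono[OF fin])
        then have "card (?D m) \<le> s" using s by simp
        then have "x \<in> lower_central_series G (card (?D m))"
          using x lower_central_series_antimono by blast
        then show "\<psi> x = 1\<^sub>m m" using less.IH[OF \<open>m < n\<close> \<psi>] by blast
      qed
    qed
  qed
  then have "lower_central_series G (Suc s) \<subseteq> {g \<in> carrier G. \<rho> g = 1\<^sub>m n}"
    using lower_central_series_carrier[of s] commutator_center_trivial
    unfolding lower_central_series.simps
    by (intro commutator_subgroup_subset subgroup_kernel) auto
  then show ?case using less.prems(2) s by auto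
qed

theorem theorem2:
  fixes G :: "('a, 'b) monoid_scheme"
  assumes "GVZ_group G"
  shows "nilpotent_group G \<and> nilpotence_class G \<le> card (cd G)"
proof -
  have G: "group G" "finite (carrier G)" using assms by (auto simp: GVZ_group_def)
  interpret group G by fact
  let ?c = "card (irreducible_degrees G)"
  \<comment> \<open>Term number \<open>?c\<close> of the series lies in every irreducible kernel,
    and \<open>normal_subgroup_eq_kernels\<close> for the trivial subgroup says that these kernels
    meet trivially.\<close>
  have "x \<in> {\<one>\<^bsub>G\<^esub>}" if x: "x \<in> lower_central_series G ?c" for x
  proof (rule normal_subgroup_eq_kernels[OF _ G(2)])
    show "{\<one>\<^bsub>G\<^esub>} \<lhd> G" by (rule one_is_normal)
    show "x \<in> carrier G" using x lower_central_series_carrier by blast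
    fix m \<psi> assume \<psi>: "irreducible_representation G m \<psi>"
    have "card {d \<in> irreducible_degrees G. d \<le> m} \<le> ?c"
      using finite_irreducible_degrees[OF G] by (intro card_mono) auto
    then show "\<psi> x = 1\<^sub>m m"
      using GVZ_lower_central_series_kernel[OF assms \<psi>] x lower_central_series_antimono by blast
  qed
  then have "lower_central_series G ?c = {\<one>\<^bsub>G\<^esub>}"
    using one_in_lower_central_series by blast
  moreover have "card (cd G) = ?c"
    unfolding cd_eq_irreducible_degrees[OF G] by (simp add: card_image inj_on_def)
  ultimately show ?thesis
    unfolding nilpotent_group_def nilpotence_class_def using G(1) by (auto intro: Least_le)
qed

end
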